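(* For any positive integers $n,k$ with $n\ge 2^{k/2}$, there exist an $n$-vertex directed graph $G$ and vertices $s,t\in V(G)$ such that every $s$-$t$ $k$-FT connectivity preserver of $G$ has $\Omega(n2^{k/2})$ edges.
   Context: A subgraph $H$ of a directed graph $G$ (with $V(H)=V(G)$, $E(H)\subseteq E(G)$) is an $s$-$t$ $k$-FT connectivity preserver of $G$ if for every edge set $F\subseteq E(G)$ with $|F|\le k$, the vertices $s$ and $t$ are strongly connected in $H-F$ if and only if they are strongly connected in $G-F$. *)

theory Defs
  imports Complex_Main "Graph_Theory.Digraph_Component"
begin

definition del_arcs :: "('a, 'b) pre_digraph \<Rightarrow> 'b set \<Rightarrow> ('a, 'b) pre_digraph" where
  "del_arcs G F = \<lparr>verts = verts G, arcs = arcs G - F, tail = tail G, head = head G\<rparr>"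

definition strongly_connected_pair :: "('a, 'b) pre_digraph \<Rightarrow> 'a \<Rightarrow> 'a \<Rightarrow> bool" where
  "strongly_connected_pair G u v \<longleftrightarrow> u \<rightarrow>\<^sup>*\<^bsub>G\<^esub> v \<and> v \<rightarrow>\<^sup>*\<^bsub>G\<^esub> u"

definition ft_connectivity_preserver ::
  "nat \<Rightarrow> 'a \<Rightarrow> 'a \<Rightarrow> ('a, 'b) pre_digraph \<Rightarrow> ('a, 'b) pre_digraph \<Rightarrow> bool" where
  "ft_connectivity_preserver k s t G H \<longleftrightarrow>
     spanning H G \<and>
     (\<forall>F \<subseteq> arcs G. finite F \<and> card F \<le> k \<longrightarrow>
        (strongly_connected_pair (del_arcs H F) s t \<longleftrightarrow>
         strongly_connected_pair (del_arcs G F) s t))"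

end

theory Submission
  imports Defs
begin

text \<open>
  The basic gadget is a complete binary out-tree of depth \<open>d \<approx> k/2\<close>, a complete binary in-tree of
  depth \<open>d\<close>, and all arcs from the leaves of the first to the leaves of the second. For leaves \<open>a\<close>
  and \<open>b\<close>, deleting the \<open>2d\<close> tree arcs that branch off the path from the root to \<open>a\<close> and join the
  path from \<open>b\<close> to the root leaves only the arc from \<open>a\<close> to \<open>b\<close> for crossing the gadget. So the gadget
  has \<open>O(2\<^sup>d)\<close> vertices and \<open>4\<^sup>d\<close> indispensable arcs. Putting \<open>n / O(2\<^sup>d)\<close> gadgets in series
  keeps each of these arcs indispensable, as \<open>s\<close> reaches \<open>t\<close> only by crossing every gadget; a single
  arc from \<open>t\<close> back to \<open>s\<close> turns reachability into strong connectivity.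
\<close>

section \<open>Cut certificates for indispensable arcs\<close>

text \<open>The fault set \<open>F\<close> leaves \<open>s\<close> and \<open>t\<close> strongly
  connected, while the cut \<open>S\<close> witnesses that every surviving way out of
  \<open>S\<close> uses \<open>e\<close>. Stating this for plain relations lets it be proved on
  structured vertices and renamed afterwards.\<close>

definition critical_arc :: "nat \<Rightarrow> 'v \<Rightarrow> 'v \<Rightarrow> ('v \<times> 'v) set \<Rightarrow> 'v \<times> 'v \<Rightarrow> bool" where
  "critical_arc k s t E e \<longleftrightarrow> e \<in> E \<and>
     (\<exists>F\<subseteq>E. finite F \<and> card F \<le> k \<and> (s, t) \<in> (E - F)\<^sup>* \<and> (t, s) \<in> (E - F)\<^sup>* \<and>
       (\<exists>S. s \<in> S \<and> t \<notin> S \<and> (\<forall>x y. (x, y) \<in> E \<and> x \<in> S \<and> y \<notin> S \<longrightarrow> (x, y) \<in> insert e F)))"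

text \<open>Transfers certificates from the type \<open>vertex\<close> to natural numbers. The cut
  becomes the image of \<open>S \<inter> V\<close>, because \<open>f\<close> is injective only on
  \<open>V\<close>.\<close>

lemma critical_arc_image:
  assumes inj: "inj_on f V" and EV: "E \<subseteq> V \<times> V" and sV: "s \<in> V" and tV: "t \<in> V"
    and crit: "critical_arc k s t E e"
  shows "critical_arc k (f s) (f t) (map_prod f f ` E) (map_prod f f e)"
proof -
  obtain F S where e: "e \<in> E" and F: "F \<subseteq> E" "finite F" "card F \<le> k"
    and st: "(s, t) \<in> (E - F)\<^sup>*" and ts: "(t, s) \<in> (E - F)\<^sup>*"
    and S: "s \<in> S" "t \<notin> S" "\<And>x y. (x, y) \<in> E \<Longrightarrow> x \<in> S \<Longrightarrow> y \<notin> S \<Longrightarrow> (x, y) \<in> insert e F"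
    using crit unfolding critical_arc_def by blast
  let ?g = "map_prod f f"
  have inj2: "inj_on ?g E"
    using inj_on_subset[OF map_prod_inj_on[OF inj inj] EV] .
  have diff: "?g ` E - ?g ` F = ?g ` (E - F)"
    using inj_on_image_set_diff[OF inj2, of E F] F(1) by auto
  have path: "(f x, f y) \<in> (?g ` E - ?g ` F)\<^sup>*" if "(x, y) \<in> (E - F)\<^sup>*" for x y
    unfolding diff using that
    by (induction rule: rtrancl_induct) (auto intro: rtrancl_into_rtrancl)
  have cut: "(x, y) \<in> insert (?g e) (?g ` F)"
    if xy: "(x, y) \<in> ?g ` E" "x \<in> f ` (S \<inter> V)" "y \<notin> f ` (S \<inter> V)" for x y
  proof -
    obtain u w where uw: "(u, w) \<in> E" "x = f u" "y = f w" using xy(1) by auto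
    have "u \<in> V" "w \<in> V" using uw(1) EV by auto
    then have "u \<in> S" "w \<notin> S"
      using xy(2,3) uw inj by (auto dest: inj_onD)
    then have "(u, w) \<in> insert e F" using S(3) uw(1) by blast
    then show ?thesis using uw by force
  qed
  have "f s \<in> f ` (S \<inter> V)" "f t \<notin> f ` (S \<inter> V)"
    using S(1,2) sV tV inj by (auto dest: inj_onD)
  moreover have "card (?g ` F) \<le> k"
    using card_image_le[OF F(2), of ?g] F(3) by linarith
  ultimately show ?thesis
    unfolding critical_arc_def using e F(1,2) path[OF st] path[OF ts] cut
    by (intro conjI exI[of _ "?g ` F"] exI[of _ "f ` (S \<inter> V)"] allI impI) (blast | simp)+
qed

lemma rtrancl_on_eq_rtrancl:
  assumes "r \<subseteq> V \<times> V" "x \<in> V"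
  shows "(x, y) \<in> rtrancl_on V r \<longleftrightarrow> (x, y) \<in> r\<^sup>*"
proof
  assume "(x, y) \<in> rtrancl_on V r"
  then show "(x, y) \<in> r\<^sup>*"
    by (induction rule: rtrancl_on.induct) (auto intro: rtrancl_into_rtrancl)
next
  assume "(x, y) \<in> r\<^sup>*"
  then show "(x, y) \<in> rtrancl_on V r"
    using assms by (induction rule: rtrancl_induct) (auto intro: rtrancl_on.intros)
qed

definition pair_graph :: "'v set \<Rightarrow> ('v \<times> 'v) set \<Rightarrow> ('v, 'v \<times> 'v) pre_digraph" where
  "pair_graph V E = \<lparr>verts = V, arcs = E, tail = fst, head = snd\<rparr>"

lemma digraph_pair_graph:
  assumes "finite V" "E \<subseteq> V \<times> V" "\<And>x. (x, x) \<notin> E"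
  shows "digraph (pair_graph V E)"
proof
  show "finite (arcs (pair_graph V E))"
    using assms(1,2) by (auto simp: pair_graph_def intro: finite_subset)
qed (use assms in \<open>auto simp: pair_graph_def arc_to_ends_def\<close>)

lemma strongly_connected_pair_del_arcs_iff:
  assumes "E \<subseteq> V \<times> V" "x \<in> V" "y \<in> V"
    and "verts H = V" "arcs H \<subseteq> E" "tail H = fst" "head H = snd"
  shows "strongly_connected_pair (del_arcs H F) x y \<longleftrightarrow>
    (x, y) \<in> (arcs H - F)\<^sup>* \<and> (y, x) \<in> (arcs H - F)\<^sup>*"
proof -
  have "arcs_ends (del_arcs H F) = arcs H - F"
    using assms by (auto simp: arcs_ends_def arc_to_ends_def del_arcs_def image_def)
  moreover have "arcs H - F \<subseteq> V \<times> V" using assms by blast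
  ultimately show ?thesis
    using assms
    by (simp add: strongly_connected_pair_def reachable_def rtrancl_on_eq_rtrancl del_arcs_def)
qed

text \<open>If \<open>e\<close> were missing from \<open>H\<close>, no arc of \<open>H\<close>
  outside \<open>F\<close> would leave \<open>S\<close>, so \<open>t\<close> would be unreachable
  from \<open>s\<close> after deleting \<open>F\<close>, although the full graph keeps the pair
  strongly connected.\<close>

lemma critical_arc_in_preserver:
  assumes EV: "E \<subseteq> V \<times> V" and sV: "s \<in> V" and tV: "t \<in> V"
    and crit: "critical_arc k s t E e"
    and pres: "ft_connectivity_preserver k s t (pair_graph V E) H"
  shows "e \<in> arcs H"
proof (rule ccontr)
  assume eH: "e \<notin> arcs H"
  obtain F S where F: "F \<subseteq> E" "finite F" "card F \<le> k"
    and st: "(s, t) \<in> (E - F)\<^sup>*" and ts: "(t, s) \<in> (E - F)\<^sup>*"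
    and S: "s \<in> S" "t \<notin> S" "\<And>x y. (x, y) \<in> E \<Longrightarrow> x \<in> S \<Longrightarrow> y \<notin> S \<Longrightarrow> (x, y) \<in> insert e F"
    using crit unfolding critical_arc_def by blast
  have H: "verts H = V" "arcs H \<subseteq> E" "tail H = fst" "head H = snd"
    using pres unfolding ft_connectivity_preserver_def spanning_def subgraph_def compatible_def
    by (auto simp: pair_graph_def)
  have "strongly_connected_pair (del_arcs (pair_graph V E) F) s t"
    using st ts
    by (subst strongly_connected_pair_del_arcs_iff[OF EV sV tV]) (auto simp: pair_graph_def)
  then have "strongly_connected_pair (del_arcs H F) s t"
    using pres F unfolding ft_connectivity_preserver_def by (auto simp: pair_graph_def)
  then have "(s, t) \<in> (arcs H - F)\<^sup>*"
    using strongly_connected_pair_del_arcs_iff[OF EV sV tV H] by blast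
  then have "t \<in> S"
    by (induction rule: rtrancl_induct) (use S H eH in blast)+
  then show False using S by blast
qed

section \<open>Root-to-leaf paths in a complete binary tree\<close>

text \<open>
  The nodes of a complete binary tree of depth \<open>d\<close> are numbered as in a heap: the root is \<open>1\<close>, the
  parent of \<open>v\<close> is \<open>v div 2\<close>, and the leaves are \<open>2\<^sup>d, \<dots>, 2\<^sup>d\<^sup>+\<^sup>1 - 1\<close>.
\<close>

definition heap_ancestors :: "nat \<Rightarrow> nat \<Rightarrow> nat set" where
  "heap_ancestors d a = (\<lambda>j. a div 2 ^ j) ` {..d}"

text \<open>A tree arc is identified by its child endpoint, so this set stands for the arcs to be
  deleted in one tree.\<close>

definition path_siblings :: "nat \<Rightarrow> nat \<Rightarrow> nat set" where
  "path_siblings d a =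
    {v. 2 \<le> v \<and> v < 2 ^ Suc d \<and> v div 2 \<in> heap_ancestors d a \<and> v \<notin> heap_ancestors d a}"

context
  fixes d a :: nat
  assumes leaf: "2 ^ d \<le> a" "a < 2 ^ Suc d"
begin

lemma leaf_div_power_eq_1: "a div 2 ^ d = 1"
  using leaf by (intro div_nat_eqI) auto

lemma one_in_heap_ancestors: "1 \<in> heap_ancestors d a"
  unfolding heap_ancestors_def using leaf_div_power_eq_1 by (metis atMost_iff imageI order_refl)

lemma leaf_div_power_less:
  assumes "0 < j" shows "a div 2 ^ j < 2 ^ d"
proof -
  have "a div 2 ^ j \<le> a div 2 ^ 1"
    using assms by (intro div_le_mono2 power_increasing) auto
  also have "\<dots> < 2 ^ d" using leaf by auto
  finally show ?thesis .
qed

lemma leaf_ancestor_eq: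
  assumes "v \<in> heap_ancestors d a" "2 ^ d \<le> v" shows "v = a"
proof -
  obtain j where j: "v = a div 2 ^ j" using assms by (auto simp: heap_ancestors_def)
  then have "j = 0" using leaf_div_power_less[of j] assms(2) by (metis not_gr_zero not_le)
  then show ?thesis using j by simp
qed

lemma leaf_div_power_bounds:
  assumes "j < d" shows "2 \<le> a div 2 ^ j" "a div 2 ^ j < 2 ^ Suc d"
proof -
  have "2 * 2 ^ j \<le> (2::nat) ^ d"
    using assms by (metis Suc_leI power_Suc power_increasing one_le_numeral)
  then have "2 * 2 ^ j \<le> a" using leaf by linarith
  then show "2 \<le> a div 2 ^ j" by (simp add: less_eq_div_iff_mult_less_eq)
  show "a div 2 ^ j < 2 ^ Suc d" using leaf(2) by (meson div_le_dividend le_less_trans)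
qed

lemma finite_path_siblings: "finite (path_siblings d a)"
  unfolding path_siblings_def by (rule finite_subset[of _ "{..<2 ^ Suc d}"]) auto

text \<open>Each of the \<open>d\<close> levels below the root has one node on the path, and that
  node has one sibling. The children of \<open>p\<close> are \<open>2 * p\<close> and
  \<open>2 * p + 1\<close>, which \<open>sib\<close> swaps.\<close>

lemma card_path_siblings: "card (path_siblings d a) \<le> d"
proof -
  define sib :: "nat \<Rightarrow> nat" where "sib x = (if even x then x + 1 else x - 1)" for x
  have sib: "v = sib x" if "v div 2 = x div 2" "v \<noteq> x" for v x
    using that unfolding sib_def by (auto elim!: evenE oddE)
  have "path_siblings d a \<subseteq> (\<lambda>j. sib (a div 2 ^ j)) ` {..<d}"
  proof
    fix v assume v: "v \<in> path_siblings d a"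
    then obtain j where j: "j \<le> d" "v div 2 = a div 2 ^ j"
      by (auto simp: path_siblings_def heap_ancestors_def)
    have "v div 2 < 2 ^ d" using v by (auto simp: path_siblings_def)
    then have "j \<noteq> 0" using j leaf by (cases j) auto
    then obtain m where m: "j = Suc m" by (cases j) auto
    have "v \<noteq> a div 2 ^ m"
      using v j m by (auto simp: path_siblings_def heap_ancestors_def)
    moreover have "v div 2 = (a div 2 ^ m) div 2"
      using j m by (metis div_mult2_eq power_Suc2)
    ultimately have "v = sib (a div 2 ^ m)" by (rule sib[rotated])
    then show "v \<in> (\<lambda>j. sib (a div 2 ^ j)) ` {..<d}" using j m by auto
  qed
  then show ?thesis
    by (metis card_image_le card_lessThan card_mono finite_imageI finite_lessThan le_trans)
qed

text \<open>\<open>f\<close> and \<open>R\<close> are kept general so that the in-tree is covered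
  too, by taking \<open>R\<close> to be a converse relation.\<close>

lemma root_leaf_path:
  assumes "\<And>v. v \<in> heap_ancestors d a \<Longrightarrow> 2 \<le> v \<Longrightarrow> v < 2 ^ Suc d \<Longrightarrow> (f (v div 2), f v) \<in> R"
  shows "(f 1, f a) \<in> R\<^sup>*"
proof -
  have "(f (a div 2 ^ j), f a) \<in> R\<^sup>*" if "j \<le> d" for j
    using that
  proof (induction j)
    case (Suc j)
    have "(f (a div 2 ^ j div 2), f (a div 2 ^ j)) \<in> R"
      using Suc.prems leaf_div_power_bounds[of j]
      by (intro assms) (auto simp: heap_ancestors_def)
    moreover have "a div 2 ^ j div 2 = a div 2 ^ Suc j"
      by (metis div_mult2_eq power_Suc2)
    ultimately show ?case
      using Suc by (auto intro: converse_rtrancl_into_rtrancl)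
  qed simp
  from this[of d] show ?thesis by (simp add: leaf_div_power_eq_1)
qed

end

section \<open>The chain of gadgets and its critical arcs\<close>

text \<open>
  \<open>Out i v\<close> and \<open>In i v\<close> are node \<open>v\<close> of the out-tree and node \<open>v\<close> of the in-tree of the \<open>i\<close>-th gadget.
\<close>

datatype vertex = Out nat nat | In nat nat

inductive_set chain_arcs :: "nat \<Rightarrow> nat \<Rightarrow> (vertex \<times> vertex) set" for d q where
  down: "i < q \<Longrightarrow> 2 \<le> v \<Longrightarrow> v < 2 ^ Suc d \<Longrightarrow> (Out i (v div 2), Out i v) \<in> chain_arcs d q"
| up: "i < q \<Longrightarrow> 2 \<le> v \<Longrightarrow> v < 2 ^ Suc d \<Longrightarrow> (In i v, In i (v div 2)) \<in> chain_arcs d q"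
| cross: "i < q \<Longrightarrow> 2 ^ d \<le> a \<Longrightarrow> a < 2 ^ Suc d \<Longrightarrow> 2 ^ d \<le> b \<Longrightarrow> b < 2 ^ Suc d \<Longrightarrow>
    (Out i a, In i b) \<in> chain_arcs d q"
| link: "Suc i < q \<Longrightarrow> (In i 1, Out (Suc i) 1) \<in> chain_arcs d q"
| wrap: "0 < q \<Longrightarrow> (In (q - 1) 1, Out 0 1) \<in> chain_arcs d q"

definition chain_verts :: "nat \<Rightarrow> nat \<Rightarrow> vertex set" where
  "chain_verts d q = {x. \<exists>i<q. \<exists>v\<in>{1..<2 ^ Suc d}. x = Out i v \<or> x = In i v}"

lemma roots_in_chain_verts:
  assumes "i < q"
  shows "Out i 1 \<in> chain_verts d q" "In i 1 \<in> chain_verts d q"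
proof -
  have "(1::nat) < 2 ^ Suc d" by (rule one_less_power) auto
  then show "Out i 1 \<in> chain_verts d q" "In i 1 \<in> chain_verts d q"
    using assms unfolding chain_verts_def by (auto simp del: power_Suc)
qed

lemma chain_arcs_subset: "chain_arcs d q \<subseteq> chain_verts d q \<times> chain_verts d q"
proof -
  have "x \<in> chain_verts d q \<and> y \<in> chain_verts d q" if "(x, y) \<in> chain_arcs d q" for x y
    using that
  proof cases
    case (cross i a b)
    have "1 \<le> a" "1 \<le> b" using cross by (meson le_trans one_le_power one_le_numeral)+
    then show ?thesis using cross by (auto simp: chain_verts_def)
  qed (use roots_in_chain_verts in \<open>auto simp: chain_verts_def\<close>)
  then show ?thesis by auto
qed

lemma chain_arcs_irrefl: "(x, x) \<notin> chain_arcs d q"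
  by (auto elim!: chain_arcs.cases)

lemma critical_arc_chain:
  assumes i: "i < q" and a: "2 ^ d \<le> a" "a < 2 ^ Suc d" and b: "2 ^ d \<le> b" "b < 2 ^ Suc d"
    and k: "2 * d \<le> k"
  shows "critical_arc k (Out 0 1) (In (q - 1) 1) (chain_arcs d q) (Out i a, In i b)"
proof -
  let ?E = "chain_arcs d q"
  define F1 where "F1 = (\<lambda>v. (Out i (v div 2), Out i v)) ` path_siblings d a"
  define F2 where "F2 = (\<lambda>v. (In i v, In i (v div 2))) ` path_siblings d b"
  \<comment> \<open>In gadget \<open>i\<close>, the in-tree nodes off the path from \<open>b\<close>
    belong to the side of \<open>s\<close>, since the undeleted arcs from leaf \<open>a\<close> lead
    to all the other leaves.\<close>
  define S where "S = {x. case x of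
      Out j v \<Rightarrow> j < i \<or> j = i \<and> v \<in> heap_ancestors d a
    | In j v \<Rightarrow> j < i \<or> j = i \<and> v \<notin> heap_ancestors d b}"
  define F where "F = F1 \<union> F2"
  have FE: "F \<subseteq> ?E"
    unfolding F_def F1_def F2_def path_siblings_def
    using i by (auto intro: chain_arcs.intros)
  have finF: "finite F"
    by (simp add: F_def F1_def F2_def finite_path_siblings[OF a] finite_path_siblings[OF b])
  have "card F1 \<le> d" "card F2 \<le> d"
    unfolding F1_def F2_def
    using card_path_siblings[OF a] card_path_siblings[OF b]
      finite_path_siblings[OF a] finite_path_siblings[OF b] card_image_le le_trans by blast+
  then have cardF: "card F \<le> k"
    using card_Un_le[of F1 F2] k unfolding F_def by linarith
  have one: "1 \<in> heap_ancestors d a" "1 \<in> heap_ancestors d b"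
    using one_in_heap_ancestors a b by blast+

  \<comment> \<open>The route through \<open>a\<close> and \<open>b\<close> works in every gadget:
    \<open>F\<close> contains only sibling arcs of gadget \<open>i\<close>, and this route uses none
    of them.\<close>
  have gadget: "(Out j 1, In j 1) \<in> (?E - F)\<^sup>*" if j: "j < q" for j
  proof -
    have "(Out j 1, Out j a) \<in> (?E - F)\<^sup>*"
      by (rule root_leaf_path[OF a])
        (use j in \<open>auto simp: F_def F1_def F2_def path_siblings_def intro: chain_arcs.down\<close>)
    moreover have "(Out j a, In j b) \<in> ?E - F"
      using j a b by (auto simp: F_def F1_def F2_def intro: chain_arcs.cross)
    moreover have "(In j 1, In j b) \<in> ((?E - F)\<inverse>)\<^sup>*"
      by (rule root_leaf_path[OF b])
        (use j in \<open>auto simp: F_def F1_def F2_def path_siblings_def intro: chain_arcs.up\<close>)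
    then have "(In j b, In j 1) \<in> (?E - F)\<^sup>*" by (simp add: rtrancl_converse)
    ultimately show ?thesis by (meson rtrancl_into_rtrancl rtrancl_trans)
  qed
  have "(Out 0 1, In j 1) \<in> (?E - F)\<^sup>*" if "j < q" for j
    using that
  proof (induction j)
    case 0
    then show ?case using gadget by blast
  next
    case (Suc j)
    have "(In j 1, Out (Suc j) 1) \<in> ?E - F"
      using chain_arcs.link[OF Suc.prems] by (auto simp: F_def F1_def F2_def)
    then show ?case
      using Suc gadget[OF Suc.prems] by (meson Suc_lessD rtrancl_into_rtrancl rtrancl_trans)
  qed
  then have st: "(Out 0 1, In (q - 1) 1) \<in> (?E - F)\<^sup>*" using i by simp
  have ts: "(In (q - 1) 1, Out 0 1) \<in> (?E - F)\<^sup>*"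
    using chain_arcs.wrap[of q d] i by (auto simp: F_def F1_def F2_def)

  \<comment> \<open>Tree arcs leaving \<open>S\<close> are exactly sibling arcs of gadget
    \<open>i\<close>. A leaving cross arc joins leaves on the two paths, hence is the chosen one;
    \<open>link\<close> and \<open>wrap\<close> never leave \<open>S\<close>.\<close>
  have cut: "(x, y) \<in> insert (Out i a, In i b) F"
    if "(x, y) \<in> ?E" and xS: "x \<in> S" and yS: "y \<notin> S" for x y
    using that(1)
  proof cases
    case (down j v)
    then have "j = i" "v \<in> path_siblings d a"
      using xS yS by (auto simp: S_def path_siblings_def)
    then show ?thesis using down by (auto simp: F_def F1_def)
  next
    case (up j v)
    then have "j = i" "v \<in> path_siblings d b"
      using xS yS by (auto simp: S_def path_siblings_def)
    then show ?thesis using up by (auto simp: F_def F2_def)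
  next
    case (cross j a' b')
    then have "j = i" "a' \<in> heap_ancestors d a" "b' \<in> heap_ancestors d b"
      using xS yS by (auto simp: S_def)
    then show ?thesis using cross leaf_ancestor_eq[OF a] leaf_ancestor_eq[OF b] by auto
  next
    case (link j)
    then show ?thesis using xS yS one by (auto simp: S_def)
  next
    case wrap
    then show ?thesis using xS yS one by (auto simp: S_def)
  qed
  have "Out 0 1 \<in> S" "In (q - 1) 1 \<notin> S"
    using i one by (auto simp: S_def)
  then show ?thesis
    unfolding critical_arc_def using chain_arcs.cross[OF i a b] FE finF cardF st ts cut
    by (intro conjI exI[of _ F] exI[of _ S]) auto
qed

section \<open>Numbering the vertices\<close>

text \<open>
  Gadget \<open>i\<close> occupies the \<open>i\<close>-th block of \<open>2 (2\<^sup>d\<^sup>+\<^sup>1 - 1)\<close> consecutive numbers, with its out-tree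
  filling the block from the bottom and its in-tree from the top.
\<close>

fun vertex_code :: "nat \<Rightarrow> vertex \<Rightarrow> nat" where
  "vertex_code d (Out i v) = i * (2 * (2 ^ Suc d - 1)) + (v - 1)"
| "vertex_code d (In i v) = i * (2 * (2 ^ Suc d - 1)) + (2 * (2 ^ Suc d - 1) - v)"

text \<open>Division by the block length \<open>M\<close> recovers the gadget. The remainder is
  below \<open>L - 1\<close> for out-tree nodes and at least \<open>L - 1\<close> for in-tree nodes,
  and it determines the node.\<close>

lemma vertex_code_inj: "inj_on (vertex_code d) (chain_verts d q)"
proof -
  define L :: nat where "L = 2 ^ Suc d"
  define M where "M = 2 * (L - 1)"
  have L: "L \<ge> 2" by (simp add: L_def)
  have dm: "(i * M + x) div M = i \<and> (i * M + x) mod M = x" if "x < M" for i x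
    using that by simp
  have out: "vertex_code d (Out i v) div M = i \<and> vertex_code d (Out i v) mod M = v - 1"
    if "v \<in> {1..<L}" for i v
    using that L dm[of "v - 1" i] by (auto simp: M_def L_def)
  have inn: "vertex_code d (In i v) div M = i \<and> vertex_code d (In i v) mod M = M - v"
    if "v \<in> {1..<L}" for i v
    using that L dm[of "M - v" i] by (auto simp: M_def L_def)
  show ?thesis
  proof (rule inj_onI)
    fix x y assume x: "x \<in> chain_verts d q" and y: "y \<in> chain_verts d q"
      and eq: "vertex_code d x = vertex_code d y"
    obtain i v where iv: "v \<in> {1..<L}" "x = Out i v \<or> x = In i v"
      using x by (auto simp: chain_verts_def L_def)
    obtain j w where jw: "w \<in> {1..<L}" "y = Out j w \<or> y = In j w"
      using y by (auto simp: chain_verts_def L_def)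
    have "vertex_code d x div M = vertex_code d y div M"
      "vertex_code d x mod M = vertex_code d y mod M" using eq by simp_all
    moreover have "M - v \<noteq> w - 1" "M - w \<noteq> v - 1" "M - v = M - w \<longleftrightarrow> v = w" "v - 1 = w - 1 \<longleftrightarrow> v = w"
      using iv(1) jw(1) L by (auto simp: M_def)
    ultimately show "x = y"
      using iv(2) jw(2) out[OF iv(1)] inn[OF iv(1)] out[OF jw(1)] inn[OF jw(1)]
      by (elim disjE) (simp_all del: vertex_code.simps)
  qed
qed

lemma vertex_code_less:
  assumes "x \<in> chain_verts d q"
  shows "vertex_code d x < q * (2 * (2 ^ Suc d - 1))"
proof -
  define L :: nat where "L = 2 ^ Suc d"
  define M where "M = 2 * (L - 1)"
  have L: "L \<ge> 2" by (simp add: L_def)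
  obtain i v where iv: "i < q" "v \<in> {1..<L}" "x = Out i v \<or> x = In i v"
    using assms by (auto simp: chain_verts_def L_def)
  have "v - 1 < M" "M - v < M" using iv L by (auto simp: M_def)
  then have "vertex_code d x < Suc i * M"
    using iv(3) vertex_code.simps[of d i v, folded L_def, folded M_def]
    by (elim disjE) (simp_all del: vertex_code.simps diff_add_assoc2 diff_add_assoc)
  also have "\<dots> \<le> q * M" using iv(1) by (intro mult_le_mono1) simp
  finally show ?thesis by (simp add: M_def L_def)
qed

section \<open>Counting critical arcs and choosing the parameters\<close>

text \<open>Each of the \<open>q\<close> gadgets contributes \<open>2 ^ d * 2 ^ d\<close> critical
  cross arcs. Numbers below \<open>n\<close> that code no chain vertex become isolated
  vertices.\<close>

lemma exists_dense_preserver_graph: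
  fixes n k d q :: nat
  assumes q: "0 < q" and n: "q * (2 * (2 ^ Suc d - 1)) \<le> n" and k: "2 * d \<le> k"
  shows "\<exists>(G :: (nat, nat \<times> nat) pre_digraph) s t.
         digraph G \<and> card (verts G) = n \<and> s \<in> verts G \<and> t \<in> verts G \<and>
         (\<forall>H. ft_connectivity_preserver k s t G H \<longrightarrow> q * 4 ^ d \<le> card (arcs H))"
proof -
  let ?f = "vertex_code d" and ?V = "chain_verts d q"
  let ?g = "map_prod ?f ?f"
  define E where "E = ?g ` chain_arcs d q"
  define s where "s = ?f (Out 0 1)"
  define t where "t = ?f (In (q - 1) 1)"
  have sV: "Out 0 1 \<in> ?V" and tV: "In (q - 1) 1 \<in> ?V"
    using q by (auto intro: roots_in_chain_verts[unfolded One_nat_def])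
  have fn: "?f x < n" if "x \<in> ?V" for x
    using vertex_code_less[OF that] n by linarith
  have EV: "E \<subseteq> {..<n} \<times> {..<n}"
    using chain_arcs_subset fn by (fastforce simp: E_def)
  have s: "s \<in> {..<n}" and t: "t \<in> {..<n}"
    using fn[OF sV] fn[OF tV] by (auto simp: s_def t_def)
  have irrefl: "(x, x) \<notin> E" for x
  proof
    assume "(x, x) \<in> E"
    then obtain u w where uw: "(u, w) \<in> chain_arcs d q" "?f u = ?f w" by (auto simp: E_def)
    then have "u = w" using chain_arcs_subset vertex_code_inj by (blast dest: inj_onD)
    then show False using uw(1) chain_arcs_irrefl by blast
  qed
  have "q * 4 ^ d \<le> card (arcs H)"
    if pres: "ft_connectivity_preserver k s t (pair_graph {..<n} E) H" for H
  proof -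
    let ?I = "{2 ^ d..<2 ^ Suc d} :: nat set"
    define h where "h = (\<lambda>(i, a, b). (Out i a, In i b))"
    define A where "A = h ` ({..<q} \<times> ?I \<times> ?I)"
    have A: "A \<subseteq> chain_arcs d q"
      by (auto simp: A_def h_def intro: chain_arcs.cross)
    have "?g e \<in> arcs H" if e: "e \<in> A" for e
    proof -
      have "critical_arc k (Out 0 1) (In (q - 1) 1) (chain_arcs d q) e"
        using e k by (auto simp: A_def h_def intro!: critical_arc_chain[unfolded One_nat_def])
      then have "critical_arc k s t E (?g e)"
        unfolding s_def t_def E_def
        by (rule critical_arc_image[OF vertex_code_inj chain_arcs_subset sV tV])
      then show ?thesis using critical_arc_in_preserver[OF EV s t _ pres] by blast
    qed
    then have sub: "?g ` A \<subseteq> arcs H" by (rule image_subsetI)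
    \<comment> \<open>Finiteness matters here: \<open>card\<close> of an infinite arc set would be
      0.\<close>
    have "arcs H \<subseteq> E"
      using pres unfolding ft_connectivity_preserver_def spanning_def subgraph_def
      by (auto simp: pair_graph_def)
    then have "finite (arcs H)"
      using EV by (meson finite_SigmaI finite_lessThan finite_subset)
    then have "card (?g ` A) \<le> card (arcs H)" using sub by (rule card_mono)
    moreover have "inj_on ?g A"
      by (rule inj_on_subset[OF map_prod_inj_on[OF vertex_code_inj vertex_code_inj]
            subset_trans[OF A chain_arcs_subset]])
    then have "card (?g ` A) = card A" by (rule card_image)
    moreover have "inj_on h ({..<q} \<times> ?I \<times> ?I)"
      by (auto simp: h_def inj_on_def)
    then have "card A = q * (2 ^ d * 2 ^ d)"
      unfolding A_def by (simp add: card_image card_cartesian_product)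
    moreover have "(2 ^ d * 2 ^ d :: nat) = 4 ^ d"
      by (simp flip: power_mult_distrib)
    ultimately show ?thesis by simp
  qed
  moreover have "digraph (pair_graph {..<n} E)"
    using EV irrefl by (intro digraph_pair_graph) auto
  moreover have "verts (pair_graph {..<n} E) = {..<n}" by (simp add: pair_graph_def)
  ultimately show ?thesis using s t by (metis card_lessThan)
qed

theorem theoremA5:
  shows "\<exists>c::real. c > 0 \<and>
    (\<forall>(n::nat) (k::nat). n > 0 \<and> k > 0 \<and> real n \<ge> 2 powr (real k / 2) \<longrightarrow>
      (\<exists>(G :: (nat, nat \<times> nat) pre_digraph) s t.
         digraph G \<and> card (verts G) = n \<and> s \<in> verts G \<and> t \<in> verts G \<and>
         (\<forall>H. ft_connectivity_preserver k s t G H \<longrightarrow>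
            real (card (arcs H)) \<ge> c * real n * 2 powr (real k / 2))))"
proof (intro exI[of _ "1/64"] conjI allI impI)
  fix n k :: nat
  assume "n > 0 \<and> k > 0 \<and> real n \<ge> 2 powr (real k / 2)"
  then have k: "k > 0" and nk: "real n \<ge> 2 powr (real k / 2)" by auto
  \<comment> \<open>Giving up two levels makes the gadget size \<open>M\<close>, which is below
    \<open>2 ^ (d + 2)\<close>, fit into \<open>n\<close>. For \<open>k < 4\<close> the subtraction
    truncates to 0, so that case is treated separately, with \<open>M = 2\<close>.\<close>
  define d where "d = k div 2 - 2"
  define M :: nat where "M = 2 * (2 ^ Suc d - 1)"
  define q where "q = n div M"
  have "(2::nat) \<le> 2 ^ Suc d" by simp
  then have M: "2 \<le> M" "M \<le> 4 * 2 ^ d" by (auto simp: M_def simp del: power_Suc) (simp add: power_Suc)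
  have "M \<le> n"
  proof (cases "k < 4")
    case True
    have "2 powr 0 < (2::real) powr (real k / 2)" using k by (intro powr_less_mono) auto
    then have "2 \<le> n" using nk by simp
    moreover have "M = 2" using True by (simp add: M_def d_def)
    ultimately show ?thesis by simp
  next
    case False
    then have "real (d + 2) \<le> real k / 2" by (simp add: d_def)
    then have "2 powr real (d + 2) \<le> (2::real) powr (real k / 2)" by (intro powr_mono) auto
    then have "2 ^ (d + 2) \<le> real n" using nk by (simp only: powr_realpow)
    then have "real (4 * 2 ^ d) \<le> real n" by (simp add: power_add)
    then show ?thesis using M by linarith
  qed
  then have q: "0 < q" using M by (simp add: q_def div_greater_zero_iff)
  have qM: "q * (2 * (2 ^ Suc d - 1)) \<le> n" unfolding q_def M_def by (rule div_times_less_eq_dividend)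
  \<comment> \<open>Rounding \<open>n / M\<close> down costs at most a factor 2, as \<open>q\<close>
    is positive. With \<open>M \<le> 4 * 2 ^ d\<close> this gives one factor 8 of the constant 64;
    the other comes from \<open>k / 2 \<le> d + 3\<close>.\<close>
  have "n < (q + 1) * M"
    using M unfolding q_def by (metis Suc_eq_plus1 dividend_less_div_times mult_Suc neq0_conv not_numeral_le_zero)
  also have "\<dots> \<le> (2 * q) * (4 * 2 ^ d)" using q M by (intro mult_le_mono) auto
  finally have "real n \<le> real (2 * q * (4 * 2 ^ d))" by (simp only: of_nat_le_iff less_imp_le)
  then have "real n \<le> 8 * real q * 2 ^ d" by simp
  moreover have "2 powr (real k / 2) \<le> (2::real) powr real (d + 3)"
    by (intro powr_mono) (auto simp: d_def)
  then have "2 powr (real k / 2) \<le> (8::real) * 2 ^ d"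
    by (simp only: powr_realpow power_add) simp
  ultimately have "real n * 2 powr (real k / 2) \<le> (8 * real q * 2 ^ d) * (8 * 2 ^ d)"
    by (intro mult_mono) auto
  also have "\<dots> = 64 * real (q * 4 ^ d)" by (simp flip: power_mult_distrib)
  finally have bound: "1 / 64 * real n * 2 powr (real k / 2) \<le> real (q * 4 ^ d)" by simp
  have "2 * d \<le> k" by (simp add: d_def)
  from exists_dense_preserver_graph[OF q qM this]
  obtain G :: "(nat, nat \<times> nat) pre_digraph" and s t where G: "digraph G" "card (verts G) = n"
    "s \<in> verts G" "t \<in> verts G"
    and H: "\<And>H. ft_connectivity_preserver k s t G H \<Longrightarrow> q * 4 ^ d \<le> card (arcs H)"
    by blast
  have "1 / 64 * real n * 2 powr (real k / 2) \<le> real (card (arcs H))"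
    if "ft_connectivity_preserver k s t G H" for H
    using order_trans[OF bound] H[OF that] of_nat_le_iff by blast
  with G show "\<exists>(G :: (nat, nat \<times> nat) pre_digraph) s t.
         digraph G \<and> card (verts G) = n \<and> s \<in> verts G \<and> t \<in> verts G \<and>
         (\<forall>H. ft_connectivity_preserver k s t G H \<longrightarrow>
            real (card (arcs H)) \<ge> 1 / 64 * real n * 2 powr (real k / 2))"
    by blast
qed simp

end
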